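(* Let $\Lambda$ be the $m\times n$ torus with vertex set $V$, edge set $E$, face set $F$, and let $\mathbf J^{\mathrm x}=(J^{\mathrm x}_p)_{p\in F}$, $\mathbf J^{\mathrm z}=(J^{\mathrm z}_s)_{s\in V}$ have non-negative entries. Let $Q$ be any operator on $(\mathbb C^2)^{\otimes E}$ that is diagonal in the $\sigma^{(3)}$ product basis, say $Q|\sigma\rangle=q(\sigma)|\sigma\rangle$ for every $\sigma\in\Omega=\{-1,+1\}^E$. Then $$\langle Q\rangle=\mathbb E_{\mathbf J^{\mathrm z}}[q(\sigma)],$$ where $\langle\cdot\rangle$ is the toric code equilibrium state with parameters $\mathbf J^{\mathrm x},\mathbf J^{\mathrm z}$, and $\mathbb E_{\mathbf J^{\mathrm z}}$ is expectation in the classical four-body Ising model with couplings $\mathbf J^{\mathrm z}$. In particular, $\langle Q\rangle$ does not depend on $\mathbf J^{\mathrm x}$.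
   Context: **Torus.** For $m,n\ge1$, $V=\{1,\dots,m\}\times\{1,\dots,n\}$ with coordinates modulo $m$ and $n$; $E$ consists of the $2mn$ edges: a horizontal edge from $(x,y)$ to $(x+1,y)$ and a vertical edge from $(x,y)$ to $(x,y+1)$ for each $(x,y)\in V$; $F$ is the set of $mn$ unit-square faces. Each vertex $s$ has four incident edges and each face $p$ four bounding edges; products over $e\sim s$, $e\sim p$ run over these. **Toric code model.** On $(\mathbb C^2)^{\otimes E}$ let $\sigma^{(1)}_e,\sigma^{(3)}_e$ act as $\begin{pmatrix}0&1\\1&0\end{pmatrix}$, $\begin{pmatrix}1&0\\0&-1\end{pmatrix}$ respectively on the factor $e$ and as the identity elsewhere. With $|+\rangle=\begin{pmatrix}1\\0\end{pmatrix}$, $|-\rangle=\begin{pmatrix}0\\1\end{pmatrix}$, the $\sigma^{(3)}$ product basis is $|\omega\rangle=\bigotimes_e|\omega_e\rangle$, $\omega\in\Omega=\{-1,+1\}^E$. Put $Z_s=\prod_{e\sim s}\sigma^{(3)}_e$, $X_p=\prod_{e\sim p}\sigma^{(1)}_e$, $H=-\sum_{p\in F}J^{\mathrm x}_pX_p-\sum_{s\in V}J^{\mathrm z}_sZ_s$, and $\langle A\rangle=\mathrm{tr}[Ae^{-H}]/\mathrm{tr}[e^{-H}]$. **Ising model.** For $\mathbf J=(J_s)_{s\in V}$ with $J_s\ge0$, $\mathbb P_{\mathbf J}$ is the probability measure on $\Omega$ with $\mathbb P_{\mathbf J}(\sigma)\propto\exp\big(\sum_{s\in V}J_s\prod_{e\sim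 s}\sigma_e\big)$, and $\mathbb E_{\mathbf J}$ is its expectation. *)

theory Defs
  imports "HOL-Probability.Probability" "Berlekamp_Zassenhaus.Finite_Field"
begin

section \<open>The torus\<close>

text \<open>The side lengths \<open>m, n \<ge> 1\<close> are the cardinalities of two arbitrary finite types,
  and coordinates are residues modulo \<open>m\<close> and \<open>n\<close>.\<close>

type_synonym ('m, 'n) vertex = "'m mod_ring \<times> 'n mod_ring"

datatype direction = Horizontal | Vertical

text \<open>The edge \<open>((x, y), Horizontal)\<close> joins \<open>(x, y)\<close> to \<open>(x + 1, y)\<close>, and
  \<open>((x, y), Vertical)\<close> joins \<open>(x, y)\<close> to \<open>(x, y + 1)\<close>.\<close>

type_synonym ('m, 'n) edge = "('m, 'n) vertex \<times> direction"

text \<open>A face is named by its lower left corner.\<close>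

type_synonym ('m, 'n) face = "'m mod_ring \<times> 'n mod_ring"

text \<open>The generator of \<open>\<int>/m\<close>; unlike the numeral \<open>1\<close> it is also available for \<open>m = 1\<close>,
  where it is \<open>0\<close>.\<close>

abbreviation unit_step :: "'m::finite mod_ring" where
  "unit_step \<equiv> of_int_mod_ring 1"

text \<open>The four edges are listed with multiplicity: if a side length is 1, then some edges are
  loops, which are incident to their endpoint twice (and dually bound a face from both sides).\<close>

definition incident_edges :: "('m::finite, 'n::finite) vertex \<Rightarrow> ('m, 'n) edge list" where
  "incident_edges = (\<lambda>(x, y).
     [((x, y), Horizontal), ((x - unit_step, y), Horizontal),
      ((x, y), Vertical), ((x, y - unit_step), Vertical)])"

definition bounding_edges :: "('m::finite, 'n::finite) face \<Rightarrow> ('m, 'n) edge list" where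
  "bounding_edges = (\<lambda>(x, y).
     [((x, y), Horizontal), ((x, y + unit_step), Horizontal),
      ((x, y), Vertical), ((x + unit_step, y), Vertical)])"

instance direction :: finite
proof
  have "UNIV = {Horizontal, Vertical}"
    using direction.exhaust by auto
  then show "finite (UNIV :: direction set)"
    by (metis finite.emptyI finite.insertI)
qed


section \<open>Spin configurations\<close>

datatype spin = Plus | Minus

instance spin :: finite
proof
  have "UNIV = {Plus, Minus}"
    using spin.exhaust by auto
  then show "finite (UNIV :: spin set)"
    by (metis finite.emptyI finite.insertI)
qed

fun spin_val :: "spin \<Rightarrow> real" where
  "spin_val Plus = 1"
| "spin_val Minus = - 1"

type_synonym ('m, 'n) config = "('m, 'n) edge \<Rightarrow> spin"


section \<open>The toric code\<close>

text \<open>The state space \<open>(\<complex>\<^sup>2)\<^sup>\<otimes>\<^sup>E\<close> is \<open>\<complex>\<^sup>\<Omega>\<close> in the coordinates given by the product basis, where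
  \<open>\<complex>\<^sup>2\<close> has its first coordinate labelled by \<open>Plus\<close> and its second one by \<open>Minus\<close>.\<close>

type_synonym ('m, 'n) operator = "complex ^ ('m, 'n) config ^ ('m, 'n) config"

definition tensor_vec :: "('e::finite \<Rightarrow> complex ^ spin) \<Rightarrow> complex ^ ('e \<Rightarrow> spin)" where
  "tensor_vec v = (\<chi> \<eta>. \<Prod>e\<in>UNIV. v e $ \<eta> e)"

definition tensor_op ::
    "('e::finite \<Rightarrow> complex ^ spin ^ spin) \<Rightarrow> complex ^ ('e \<Rightarrow> spin) ^ ('e \<Rightarrow> spin)" where
  "tensor_op A = (\<chi> \<eta> \<eta>'. \<Prod>e\<in>UNIV. A e $ \<eta> e $ \<eta>' e)"

definition spin_ket :: "spin \<Rightarrow> complex ^ spin" where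
  "spin_ket a = axis a 1"

definition ket :: "('e::finite \<Rightarrow> spin) \<Rightarrow> complex ^ ('e \<Rightarrow> spin)" where
  "ket \<omega> = tensor_vec (\<lambda>e. spin_ket (\<omega> e))"

definition pauli_x :: "complex ^ spin ^ spin" where
  "pauli_x = (\<chi> a b. if a = b then 0 else 1)"

definition pauli_z :: "complex ^ spin ^ spin" where
  "pauli_z = (\<chi> a b. if a = b then complex_of_real (spin_val a) else 0)"

definition on_edge ::
    "complex ^ spin ^ spin \<Rightarrow> 'e::finite \<Rightarrow> complex ^ ('e \<Rightarrow> spin) ^ ('e \<Rightarrow> spin)" where
  "on_edge A e = tensor_op (\<lambda>f. if f = e then A else mat 1)"

definition op_prod :: "(complex ^ 'i::finite ^ 'i) list \<Rightarrow> complex ^ 'i ^ 'i" where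
  "op_prod As = foldr (**) As (mat 1)"

definition vertex_op :: "('m::finite, 'n::finite) vertex \<Rightarrow> ('m, 'n) operator" where
  "vertex_op s = op_prod (map (on_edge pauli_z) (incident_edges s))"

definition face_op :: "('m::finite, 'n::finite) face \<Rightarrow> ('m, 'n) operator" where
  "face_op p = op_prod (map (on_edge pauli_x) (bounding_edges p))"

definition hamiltonian ::
    "(('m::finite, 'n::finite) face \<Rightarrow> real) \<Rightarrow> (('m, 'n) vertex \<Rightarrow> real) \<Rightarrow> ('m, 'n) operator"
  where
  "hamiltonian Jx Jz =
     - (\<Sum>p\<in>UNIV. Jx p *\<^sub>R face_op p) - (\<Sum>s\<in>UNIV. Jz s *\<^sub>R vertex_op s)"

definition op_power :: "complex ^ 'i::finite ^ 'i \<Rightarrow> nat \<Rightarrow> complex ^ 'i ^ 'i" where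
  "op_power A k = (((**) A) ^^ k) (mat 1)"

text \<open>\<^term>\<open>exp\<close> is not available on this matrix type, which is not an instance
  of \<^class>\<open>real_normed_algebra_1\<close>. The series always converges, as shown below.\<close>

definition op_exp :: "complex ^ 'i::finite ^ 'i \<Rightarrow> complex ^ 'i ^ 'i" where
  "op_exp A = (\<Sum>k. (1 / fact k) *\<^sub>R op_power A k)"

lemma op_power_entry_bound:
  fixes A :: "complex ^ 'i::finite ^ 'i"
  assumes b: "\<And>i j. norm (A $ i $ j) \<le> b"
  shows "norm (op_power A k $ i $ j) \<le> (real CARD('i) * b) ^ k"
proof (induction k arbitrary: i j)
  case 0
  show ?case by (simp add: op_power_def mat_def)
next
  case (Suc k)
  have b0: "0 \<le> b" using b norm_ge_zero order_trans by blast
  have "norm (op_power A (Suc k) $ i $ j) = norm (\<Sum>l\<in>UNIV. A $ i $ l * op_power A k $ l $ j)"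
    by (simp add: op_power_def matrix_matrix_mult_def)
  also have "\<dots> \<le> (\<Sum>l\<in>(UNIV::'i set). b * (real CARD('i) * b) ^ k)"
    by (rule sum_norm_le) (simp add: norm_mult mult_mono b b0 Suc)
  also have "\<dots> = (real CARD('i) * b) ^ Suc k"
    by simp
  finally show ?case .
qed

lemma summable_op_exp:
  fixes A :: "complex ^ 'i::finite ^ 'i"
  shows "summable (\<lambda>k. (1 / fact k) *\<^sub>R op_power A k)"
proof -
  define b where "b = (\<Sum>i\<in>UNIV. \<Sum>j\<in>UNIV. norm (A $ i $ j))"
  define c where "c = real CARD('i) * b"
  have b: "norm (A $ i $ j) \<le> b" for i j
  proof -
    have "norm (A $ i $ j) \<le> (\<Sum>j\<in>UNIV. norm (A $ i $ j))"
      by (rule member_le_sum) auto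
    also have "\<dots> \<le> b"
      unfolding b_def
      by (rule member_le_sum[where f = "\<lambda>i. \<Sum>j\<in>UNIV. norm (A $ i $ j)"])
        (auto intro: sum_nonneg)
    finally show ?thesis .
  qed
  have norm_le: "norm (op_power A k) \<le> (\<Sum>i\<in>(UNIV::'i set). \<Sum>j\<in>(UNIV::'i set). c ^ k)" for k
  proof -
    have "norm (op_power A k) \<le> (\<Sum>i\<in>UNIV. norm (op_power A k $ i))"
      by (simp add: norm_vec_def L2_set_le_sum)
    also have "\<dots> \<le> (\<Sum>i\<in>UNIV. \<Sum>j\<in>UNIV. norm (op_power A k $ i $ j))"
      by (intro sum_mono) (simp add: norm_vec_def L2_set_le_sum)
    also have "\<dots> \<le> (\<Sum>i\<in>(UNIV::'i set). \<Sum>j\<in>(UNIV::'i set). c ^ k)"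
      unfolding c_def by (intro sum_mono op_power_entry_bound b)
    finally show ?thesis .
  qed
  have "summable (\<lambda>k. (real CARD('i) * real CARD('i)) * (c ^ k /\<^sub>R fact k))"
    by (intro summable_mult summable_exp_generic)
  then show ?thesis
  proof (rule summable_comparison_test')
    fix k :: nat
    show "norm ((1 / fact k) *\<^sub>R op_power A k)
        \<le> (real CARD('i) * real CARD('i)) * (c ^ k /\<^sub>R fact k)"
      using norm_le[of k] by (simp add: divide_simps mult_ac)
  qed
qed

definition toric_expectation ::
    "(('m::finite, 'n::finite) face \<Rightarrow> real) \<Rightarrow> (('m, 'n) vertex \<Rightarrow> real)
      \<Rightarrow> ('m, 'n) operator \<Rightarrow> complex" where
  "toric_expectation Jx Jz A =
     trace (A ** op_exp (- hamiltonian Jx Jz)) / trace (op_exp (- hamiltonian Jx Jz))"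


section \<open>The four-body Ising model\<close>

definition ising_weight ::
    "(('m::finite, 'n::finite) vertex \<Rightarrow> real) \<Rightarrow> ('m, 'n) config \<Rightarrow> real" where
  "ising_weight J \<sigma> =
     exp (\<Sum>s\<in>UNIV. J s * prod_list (map (\<lambda>e. spin_val (\<sigma> e)) (incident_edges s)))"

definition ising ::
    "(('m::finite, 'n::finite) vertex \<Rightarrow> real) \<Rightarrow> ('m, 'n) config pmf" where
  "ising J = embed_pmf (\<lambda>\<sigma>. ising_weight J \<sigma> / (\<Sum>\<tau>\<in>UNIV. ising_weight J \<tau>))"

text \<open>The following confirms that the mass function given to \<^const>\<open>embed_pmf\<close> is normalised.\<close>

lemma pmf_ising:
  "pmf (ising J) \<sigma> = ising_weight J \<sigma> / (\<Sum>\<tau>\<in>UNIV. ising_weight J \<tau>)"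
proof -
  let ?Z = "\<Sum>\<tau>\<in>UNIV. ising_weight J \<tau>"
  have Z: "?Z > 0"
    by (intro sum_pos) (auto simp: ising_weight_def)
  have nonneg: "0 \<le> ising_weight J \<tau> / ?Z" for \<tau>
    using Z by (simp add: ising_weight_def)
  have "(\<integral>\<^sup>+\<tau>. ennreal (ising_weight J \<tau> / ?Z) \<partial>count_space UNIV)
      = (\<Sum>\<tau>\<in>UNIV. ennreal (ising_weight J \<tau> / ?Z))"
    by (rule nn_integral_count_space_finite) simp
  also have "\<dots> = ennreal (\<Sum>\<tau>\<in>UNIV. ising_weight J \<tau> / ?Z)"
    by (rule sum_ennreal) (rule nonneg)
  also have "(\<Sum>\<tau>\<in>UNIV. ising_weight J \<tau> / ?Z) = 1"
    using Z by (simp flip: sum_divide_distrib)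
  finally show ?thesis
    unfolding ising_def by (intro pmf_embed_pmf nonneg) simp
qed

end

theory Submission
  imports Defs
begin

text \<open>
  Write \<open>-H = A + D\<close>, where \<open>A = \<Sum>\<^sub>p J\<^sup>x\<^sub>p X\<^sub>p\<close> is a weighted sum of permutations of the
  product basis and \<open>D = \<Sum>\<^sub>s J\<^sup>z\<^sub>s Z\<^sub>s\<close> is diagonal; the diagonal entry of \<open>D\<close> at \<open>\<sigma>\<close> is the Ising exponent of \<open>\<sigma>\<close>.
  A face and a vertex always share an even number of edges, counted with multiplicity, so flipping
  the boundary of a face leaves every vertex product unchanged. Hence \<open>A\<close> only connects
  configurations with the same Ising exponent, and \<open>e\<^bsup>A + D\<^esup> = e\<^sup>D e\<^sup>A\<close> (lemma \<open>op_exp_add_diag\<close>).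

  Since \<open>A\<close> acts by flipping spins irrespective of their values, it is invariant under the group
  \<open>{-1, +1}\<^sup>E\<close> acting on configurations by pointwise multiplication. This action is transitive, so
  the diagonal entries of \<open>e\<^sup>A\<close> all have one common value \<open>c\<close>; and \<open>c \<noteq> 0\<close> because \<open>A\<close> has
  non-negative entries. The diagonal entry of \<open>e\<^bsup>-H\<^esup>\<close> at \<open>\<sigma>\<close> is therefore \<open>c\<close> times the Ising
  weight of \<open>\<sigma>\<close>. A diagonal observable sees only these entries, and \<open>c\<close>, which carries the whole
  dependence on \<open>J\<^sup>x\<close>, cancels between numerator and denominator.
\<close>

section \<open>Exponentials of matrices, entry by entry\<close>

definition diag_mat :: "('i \<Rightarrow> complex) \<Rightarrow> complex ^ 'i ^ 'i" where
  "diag_mat d = (\<chi> i j. if i = j then d i else 0)"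

lemma diag_mat_entry: "diag_mat d $ i $ j = (if i = j then d i else 0)"
  by (simp add: diag_mat_def)

lemma op_power_0_entry: "op_power A 0 $ i $ j = (if i = j then 1 else 0)"
  by (simp add: op_power_def mat_def)

lemma op_power_Suc_entry:
  "op_power A (Suc k) $ i $ j = (\<Sum>l\<in>UNIV. A $ i $ l * op_power A k $ l $ j)"
  by (simp add: op_power_def matrix_matrix_mult_def)

lemma op_exp_entry_sums:
  "(\<lambda>k. op_power A k $ i $ j / fact k) sums (op_exp A $ i $ j)"
proof -
  have "(\<lambda>k. (1 / fact k) *\<^sub>R op_power A k) sums op_exp A"
    unfolding op_exp_def by (rule summable_sums[OF summable_op_exp])
  then have "(\<lambda>k. ((1 / fact k) *\<^sub>R op_power A k) $ i $ j) sums (op_exp A $ i $ j)"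
    by (intro bounded_linear.sums[OF bounded_linear_vec_nth])
  then show ?thesis
    by (simp add: scaleR_conv_of_real[where 'a = complex])
qed

lemma summable_norm_op_exp_entry:
  "summable (\<lambda>k. norm (op_power A k $ i $ j / fact k))"
proof -
  have "summable (\<lambda>k. (real CARD('a) * norm A) ^ k /\<^sub>R fact k)"
    by (rule summable_exp_generic)
  then show ?thesis
  proof (rule summable_comparison_test')
    fix k :: nat
    show "norm (norm (op_power A k $ i $ j / fact k)) \<le> (real CARD('a) * norm A) ^ k /\<^sub>R fact k"
      using op_power_entry_bound[of A "norm A" k i j,
          OF order_trans[OF Finite_Cartesian_Product.norm_nth_le
            Finite_Cartesian_Product.norm_nth_le]]
      by (simp add: norm_divide divide_simps mult_ac)
  qed
qed

lemma binomial_sum_step: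
  fixes z :: complex and u :: "nat \<Rightarrow> complex"
  shows "(\<Sum>j\<le>k. of_nat (k choose j) * z ^ (k - j) * u (Suc j))
      + z * (\<Sum>j\<le>k. of_nat (k choose j) * z ^ (k - j) * u j)
    = (\<Sum>j\<le>Suc k. of_nat (Suc k choose j) * z ^ (Suc k - j) * u j)"
proof -
  have "z * (\<Sum>j\<le>k. of_nat (k choose j) * z ^ (k - j) * u j)
      = (\<Sum>j\<le>k. of_nat (k choose j) * z ^ (Suc k - j) * u j)"
    unfolding sum_distrib_left by (rule sum.cong) (auto simp: Suc_diff_le)
  \<comment> \<open>The summand \<open>j = Suc k\<close> vanishes and can be added, which aligns the two ranges.\<close>
  also have "\<dots> = (\<Sum>j\<le>Suc k. of_nat (k choose j) * z ^ (Suc k - j) * u j)"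
    by simp
  also have "\<dots> = z ^ Suc k * u 0
      + (\<Sum>j\<le>k. of_nat (k choose Suc j) * z ^ (k - j) * u (Suc j))"
    by (subst sum.atMost_Suc_shift) simp
  finally show ?thesis
    by (subst sum.atMost_Suc_shift) (simp add: sum.distrib algebra_simps)
qed

text \<open>The hypothesis says that \<open>A\<close> and \<open>diag_mat d\<close> commute. Along any path of nonzero entries of
  \<open>A\<close> the value of \<open>d\<close> stays that of the starting index, so in row \<open>i\<close> the diagonal part acts as
  the scalar \<open>d i\<close> and the scalar binomial formula applies.\<close>

lemma op_power_add_diag:
  assumes "\<And>i j. A $ i $ j \<noteq> 0 \<Longrightarrow> d i = d j"
  shows "op_power (A + diag_mat d) k $ i $ j
    = (\<Sum>l\<le>k. of_nat (k choose l) * d i ^ (k - l) * op_power A l $ i $ j)"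
proof (induction k arbitrary: i)
  case 0
  show ?case by (simp add: op_power_0_entry)
next
  case (Suc k)
  let ?S = "\<lambda>x r. \<Sum>l\<le>k. of_nat (k choose l) * x ^ (k - l) * op_power A l $ r $ j"
  have "op_power (A + diag_mat d) (Suc k) $ i $ j
      = (\<Sum>r\<in>UNIV. A $ i $ r * ?S (d r) r) + (\<Sum>r\<in>UNIV. (if i = r then d i else 0) * ?S (d r) r)"
    by (simp add: op_power_Suc_entry Suc.IH diag_mat_entry distrib_right sum.distrib)
  also have "(\<Sum>r\<in>UNIV. (if i = r then d i else 0) * ?S (d r) r) = d i * ?S (d i) i"
    by (simp add: if_distrib[where f = "\<lambda>x. x * _"] cong: if_cong)
  also have "(\<Sum>r\<in>UNIV. A $ i $ r * ?S (d r) r) = (\<Sum>r\<in>UNIV. A $ i $ r * ?S (d i) r)"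
  proof (rule sum.cong)
    fix r
    show "A $ i $ r * ?S (d r) r = A $ i $ r * ?S (d i) r"
      using assms[of i r] by (cases "A $ i $ r = 0") auto
  qed simp
  also have "\<dots> = (\<Sum>l\<le>k. of_nat (k choose l) * d i ^ (k - l) * op_power A (Suc l) $ i $ j)"
    unfolding op_power_Suc_entry sum_distrib_left
    by (subst sum.swap) (simp add: mult_ac)
  finally show ?case
    by (rule trans[OF _ binomial_sum_step])
qed

text \<open>The formula \<open>e\<^bsup>A + D\<^esup> = e\<^sup>D e\<^sup>A\<close> for a diagonal \<open>D\<close> commuting with \<open>A\<close>: by the binomial
  formula, the exponential series of the sum is the Cauchy product of the two series.\<close>

lemma op_exp_add_diag:
  assumes "\<And>i j. A $ i $ j \<noteq> 0 \<Longrightarrow> d i = d j"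
  shows "op_exp (A + diag_mat d) $ i $ j = exp (d i) * op_exp A $ i $ j"
proof -
  let ?a = "\<lambda>l. op_power A l $ i $ j / fact l"
  let ?e = "\<lambda>l. d i ^ l /\<^sub>R fact l"
  have conv: "op_power (A + diag_mat d) k $ i $ j / fact k = (\<Sum>l\<le>k. ?a l * ?e (k - l))" for k
  proof -
    have "of_nat (k choose l) * d i ^ (k - l) * op_power A l $ i $ j / fact k
        = ?a l * ?e (k - l)" if "l \<le> k" for l
      using that
      by (simp add: binomial_fact scaleR_conv_of_real field_simps)
    then show ?thesis
      by (simp add: op_power_add_diag[OF assms] sum_divide_distrib)
  qed
  have "(\<lambda>k. \<Sum>l\<le>k. ?a l * ?e (k - l)) sums ((\<Sum>k. ?a k) * (\<Sum>k. ?e k))"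
    by (rule Cauchy_product_sums[OF summable_norm_op_exp_entry summable_norm_exp])
  moreover have "(\<Sum>k. ?a k) = op_exp A $ i $ j"
    using op_exp_entry_sums by (rule sums_unique[symmetric])
  moreover have "(\<Sum>k. ?e k) = exp (d i)"
    by (simp add: exp_def)
  ultimately have "(\<lambda>k. op_power (A + diag_mat d) k $ i $ j / fact k)
      sums (exp (d i) * op_exp A $ i $ j)"
    by (simp only: conv mult.commute)
  then show ?thesis
    using op_exp_entry_sums sums_unique2 by blast
qed

lemma op_exp_invariant:
  fixes A :: "complex ^ 'i::finite ^ 'i"
  assumes f: "bij f" and A: "\<And>i j. A $ f i $ f j = A $ i $ j"
  shows "op_exp A $ f i $ f j = op_exp A $ i $ j"
proof -
  have "op_power A k $ f i $ f j = op_power A k $ i $ j" for k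
  proof (induction k arbitrary: i)
    case 0
    show ?case
      using f by (simp add: op_power_0_entry bij_is_inj inj_eq)
  next
    case (Suc k)
    have "op_power A (Suc k) $ f i $ f j = (\<Sum>l\<in>UNIV. A $ f i $ f l * op_power A k $ f l $ f j)"
      unfolding op_power_Suc_entry by (rule sum.reindex_bij_betw[symmetric]) (rule f)
    also have "\<dots> = op_power A (Suc k) $ i $ j"
      by (simp add: op_power_Suc_entry A Suc.IH)
    finally show ?case .
  qed
  then show ?thesis
    using op_exp_entry_sums[of A "f i" "f j"] op_exp_entry_sums[of A i j] sums_unique2 by simp
qed

text \<open>In the series of a diagonal entry all terms are non-negative, and the first one is \<open>1\<close>.\<close>

lemma op_exp_diagonal_nonzero:
  fixes A :: "complex ^ 'i::finite ^ 'i"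
  assumes "\<And>i j. A $ i $ j \<in> \<real>\<^sub>\<ge>\<^sub>0"
  shows "op_exp A $ i $ i \<noteq> 0"
proof -
  have nonneg: "op_power A k $ i $ j \<in> \<real>\<^sub>\<ge>\<^sub>0" for k i j
  proof (induction k arbitrary: i)
    case 0
    show ?case by (simp add: op_power_0_entry)
  next
    case (Suc k)
    have "(\<Sum>l\<in>S. A $ i $ l * op_power A k $ l $ j) \<in> \<real>\<^sub>\<ge>\<^sub>0" for S :: "'i set"
      by (induction S rule: infinite_finite_induct)
        (simp_all add: nonneg_Reals_add_I nonneg_Reals_mult_I assms Suc.IH)
    then show ?case
      by (simp add: op_power_Suc_entry)
  qed
  have sums: "(\<lambda>k. Re (op_power A k $ i $ i / fact k)) sums Re (op_exp A $ i $ i)"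
    by (rule sums_Re[OF op_exp_entry_sums])
  have "Re (op_power A k $ i $ i / fact k) \<ge> 0" for k
    using nonneg_Reals_divide_I[OF nonneg[of k i i] nonneg_Reals_of_nat_I[of "fact k"]]
    by (simp add: complex_nonneg_Reals_iff)
  then have "(\<Sum>k\<in>{0}. Re (op_power A k $ i $ i / fact k)) \<le> (\<Sum>k. Re (op_power A k $ i $ i / fact k))"
    by (intro sum_le_suminf sums_summable[OF sums]) auto
  then have "1 \<le> Re (op_exp A $ i $ i)"
    using sums_unique[OF sums] by (simp add: op_power_0_entry)
  then show ?thesis by auto
qed


section \<open>Spin flips and spin multiplication\<close>

definition flip :: "'e \<Rightarrow> ('e \<Rightarrow> spin) \<Rightarrow> 'e \<Rightarrow> spin" where
  "flip e \<sigma> = \<sigma>(e := (if \<sigma> e = Plus then Minus else Plus))"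

definition flips :: "'e list \<Rightarrow> ('e \<Rightarrow> spin) \<Rightarrow> 'e \<Rightarrow> spin" where
  "flips = foldr flip"

definition spin_mult :: "('e \<Rightarrow> spin) \<Rightarrow> ('e \<Rightarrow> spin) \<Rightarrow> 'e \<Rightarrow> spin" where
  "spin_mult \<tau> \<sigma> e = (if \<tau> e = \<sigma> e then Plus else Minus)"

lemma flips_Nil [simp]: "flips [] \<sigma> = \<sigma>"
  and flips_Cons [simp]: "flips (e # es) \<sigma> = flip e (flips es \<sigma>)"
  by (simp_all add: flips_def)

lemma spin_val_flip: "spin_val (flip e \<sigma> f) = (if e = f then - 1 else 1) * spin_val (\<sigma> f)"
  by (cases "\<sigma> f") (auto simp: flip_def)

lemma spin_mult_involution: "spin_mult \<tau> (spin_mult \<tau> \<sigma>) = \<sigma>"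
proof
  fix e show "spin_mult \<tau> (spin_mult \<tau> \<sigma>) e = \<sigma> e"
    by (cases "\<sigma> e"; cases "\<tau> e") (auto simp: spin_mult_def)
qed

lemma bij_spin_mult: "bij (spin_mult \<tau>)"
  by (rule o_bij[of "spin_mult \<tau>"]) (auto simp: fun_eq_iff spin_mult_involution)

lemma spin_mult_transitive: "spin_mult (spin_mult \<sigma> \<tau>) \<sigma> = \<tau>"
proof
  fix e show "spin_mult (spin_mult \<sigma> \<tau>) \<sigma> e = \<tau> e"
    by (cases "\<sigma> e"; cases "\<tau> e") (auto simp: spin_mult_def)
qed

lemma flip_spin_mult: "flip e (spin_mult \<tau> \<sigma>) = spin_mult \<tau> (flip e \<sigma>)"
proof
  fix f show "flip e (spin_mult \<tau> \<sigma>) f = spin_mult \<tau> (flip e \<sigma>) f"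
    by (cases "\<sigma> f"; cases "\<tau> f") (auto simp: spin_mult_def flip_def)
qed

lemma flips_spin_mult: "flips es (spin_mult \<tau> \<sigma>) = spin_mult \<tau> (flips es \<sigma>)"
  by (induction es) (auto simp: flip_spin_mult)

definition vertex_spin :: "('m::finite, 'n::finite) vertex \<Rightarrow> ('m, 'n) config \<Rightarrow> real" where
  "vertex_spin s \<sigma> = prod_list (map (\<lambda>e. spin_val (\<sigma> e)) (incident_edges s))"

text \<open>The vertices with an edge in common with the boundary of a face are its four corners, and
  at each of them one horizontal and one vertical boundary edge meet. So every equality between a
  horizontal edge at the vertex and one around the face goes with an equality between two vertical
  edges, and the two signs cancel. This matching concerns positions in the two lists and survives
  repetitions in them, so it covers side length 1.\<close>

lemma vertex_spin_flips_bounding_edges: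
  "vertex_spin s (flips (bounding_edges p) \<sigma>) = vertex_spin s \<sigma>"
proof -
  obtain a b where s: "s = (a, b)" by (cases s)
  obtain x y where p: "p = (x, y)" by (cases p)
  show ?thesis
    unfolding s p vertex_spin_def incident_edges_def bounding_edges_def
    \<comment> \<open>Moving subtractions across turns the eight equality conditions into four matching pairs.\<close>
    by (simp add: spin_val_flip eq_diff_eq)
qed


section \<open>The operators of the toric code in the product basis\<close>

lemma prod_of_bool_eq:
  fixes P :: "'e::finite \<Rightarrow> bool"
  shows "(\<Prod>e\<in>UNIV. (if P e then c e else 0 :: complex)) = (if \<forall>e. P e then \<Prod>e\<in>UNIV. c e else 0)"
  by (auto intro: prod.cong)

lemma ket_entry: "ket \<omega> $ \<eta> = (if \<eta> = \<omega> then 1 else 0)"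
proof -
  have "ket \<omega> $ \<eta> = (\<Prod>e\<in>UNIV. if \<eta> e = \<omega> e then 1 else 0)"
    by (simp add: ket_def tensor_vec_def spin_ket_def axis_def)
  then show ?thesis
    by (simp add: prod_of_bool_eq fun_eq_iff)
qed

lemma on_edge_pauli_x_entry: "on_edge pauli_x e $ \<eta> $ \<eta>' = (if \<eta> = flip e \<eta>' then 1 else 0)"
proof -
  have spin: "a \<noteq> b \<longleftrightarrow> a = (if b = Plus then Minus else Plus)" for a b
    by (cases a; cases b) auto
  have "on_edge pauli_x e $ \<eta> $ \<eta>' = (\<Prod>f\<in>UNIV. if \<eta> f = flip e \<eta>' f then 1 else 0)"
    unfolding on_edge_def tensor_op_def
    by (auto simp: pauli_x_def mat_def flip_def spin intro!: prod.cong)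
  then show ?thesis
    by (simp add: prod_of_bool_eq fun_eq_iff)
qed

lemma on_edge_pauli_z_entry:
  "on_edge pauli_z e $ \<eta> $ \<eta>' = (if \<eta> = \<eta>' then of_real (spin_val (\<eta> e)) else 0)"
proof -
  have "on_edge pauli_z e $ \<eta> $ \<eta>'
      = (\<Prod>f\<in>UNIV. if \<eta> f = \<eta>' f then if f = e then of_real (spin_val (\<eta> e)) else 1 else 0)"
    unfolding on_edge_def tensor_op_def
    by (auto simp: pauli_z_def mat_def intro!: prod.cong)
  then show ?thesis
    by (simp add: prod_of_bool_eq fun_eq_iff)
qed

lemma op_prod_pauli_x_entry:
  "op_prod (map (on_edge pauli_x) es) $ \<eta> $ \<eta>' = (if \<eta> = flips es \<eta>' then 1 else 0)"
proof (induction es arbitrary: \<eta>)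
  case Nil
  show ?case by (simp add: op_prod_def mat_def)
next
  case (Cons e es)
  have "op_prod (map (on_edge pauli_x) (e # es)) $ \<eta> $ \<eta>'
      = (\<Sum>\<rho>\<in>UNIV. on_edge pauli_x e $ \<eta> $ \<rho> * op_prod (map (on_edge pauli_x) es) $ \<rho> $ \<eta>')"
    by (simp add: op_prod_def matrix_matrix_mult_def)
  then show ?case
    by (simp add: Cons.IH on_edge_pauli_x_entry if_distrib[where f = "\<lambda>x. _ * x"] cong: if_cong)
qed

lemma op_prod_pauli_z_entry:
  "op_prod (map (on_edge pauli_z) es) $ \<eta> $ \<eta>'
    = (if \<eta> = \<eta>' then of_real (prod_list (map (\<lambda>e. spin_val (\<eta> e)) es)) else 0)"
proof (induction es arbitrary: \<eta>)
  case Nil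
  show ?case by (simp add: op_prod_def mat_def)
next
  case (Cons e es)
  have "op_prod (map (on_edge pauli_z) (e # es)) $ \<eta> $ \<eta>'
      = (\<Sum>\<rho>\<in>UNIV. on_edge pauli_z e $ \<eta> $ \<rho> * op_prod (map (on_edge pauli_z) es) $ \<rho> $ \<eta>')"
    by (simp add: op_prod_def matrix_matrix_mult_def)
  then show ?case
    by (simp add: Cons.IH on_edge_pauli_z_entry if_distrib[where f = "\<lambda>x. _ * x"] cong: if_cong)
qed

lemma face_op_entry:
  "face_op p $ \<eta> $ \<eta>' = (if \<eta> = flips (bounding_edges p) \<eta>' then 1 else 0)"
  by (simp add: face_op_def op_prod_pauli_x_entry)

lemma vertex_op_entry:
  "vertex_op s $ \<eta> $ \<eta>' = (if \<eta> = \<eta>' then of_real (vertex_spin s \<eta>) else 0)"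
  by (simp add: vertex_op_def op_prod_pauli_z_entry vertex_spin_def)

definition face_sum :: "(('m::finite, 'n::finite) face \<Rightarrow> real) \<Rightarrow> ('m, 'n) operator" where
  "face_sum Jx = (\<Sum>p\<in>UNIV. Jx p *\<^sub>R face_op p)"

definition ising_exponent ::
    "(('m::finite, 'n::finite) vertex \<Rightarrow> real) \<Rightarrow> ('m, 'n) config \<Rightarrow> real" where
  "ising_exponent Jz \<sigma> = (\<Sum>s\<in>UNIV. Jz s * vertex_spin s \<sigma>)"

lemma ising_weight_eq: "ising_weight Jz \<sigma> = exp (ising_exponent Jz \<sigma>)"
  by (simp add: ising_weight_def ising_exponent_def vertex_spin_def)

lemma face_sum_entry:
  "face_sum Jx $ \<eta> $ \<eta>'
    = (\<Sum>p\<in>UNIV. of_real (Jx p) * (if \<eta> = flips (bounding_edges p) \<eta>' then 1 else 0))"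
  by (simp add: face_sum_def sum_component face_op_entry scaleR_conv_of_real[where 'a = complex])

lemma minus_hamiltonian_eq:
  "- hamiltonian Jx Jz = face_sum Jx + diag_mat (\<lambda>\<sigma>. of_real (ising_exponent Jz \<sigma>))"
proof -
  have "(\<Sum>s\<in>UNIV. Jz s *\<^sub>R vertex_op s) = diag_mat (\<lambda>\<sigma>. of_real (ising_exponent Jz \<sigma>))"
    by (auto simp: vec_eq_iff diag_mat_entry sum_component vertex_op_entry ising_exponent_def
        scaleR_conv_of_real[where 'a = complex])
  then show ?thesis
    by (simp add: hamiltonian_def face_sum_def)
qed

lemma ising_exponent_face_sum:
  assumes "face_sum Jx $ \<eta> $ \<eta>' \<noteq> 0"
  shows "ising_exponent Jz \<eta> = ising_exponent Jz \<eta>'"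
proof -
  obtain p where "\<eta> = flips (bounding_edges p) \<eta>'"
    using assms unfolding face_sum_entry
    by (auto elim!: sum.not_neutral_contains_not_neutral split: if_splits)
  then show ?thesis
    by (simp add: ising_exponent_def vertex_spin_flips_bounding_edges)
qed

lemma face_sum_spin_mult:
  "face_sum Jx $ spin_mult \<tau> \<eta> $ spin_mult \<tau> \<eta>' = face_sum Jx $ \<eta> $ \<eta>'"
  by (simp add: face_sum_entry flips_spin_mult inj_eq[OF bij_is_inj[OF bij_spin_mult]])

lemma op_exp_face_sum_diagonal:
  "op_exp (face_sum Jx) $ \<sigma> $ \<sigma> = op_exp (face_sum Jx) $ \<tau> $ \<tau>"
  using op_exp_invariant[of "spin_mult (spin_mult \<sigma> \<tau>)" "face_sum Jx" \<sigma> \<sigma>,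
      OF bij_spin_mult face_sum_spin_mult]
  by (simp add: spin_mult_transitive)

lemma boltzmann_diagonal:
  assumes "\<And>p. 0 \<le> Jx p"
  obtains c where "c \<noteq> 0"
    and "\<And>\<sigma>. op_exp (- hamiltonian Jx Jz) $ \<sigma> $ \<sigma> = c * of_real (ising_weight Jz \<sigma>)"
proof
  let ?c = "op_exp (face_sum Jx) $ (\<lambda>_. Plus) $ (\<lambda>_. Plus)"
  show "op_exp (- hamiltonian Jx Jz) $ \<sigma> $ \<sigma> = ?c * of_real (ising_weight Jz \<sigma>)" for \<sigma>
  proof -
    have "op_exp (- hamiltonian Jx Jz) $ \<sigma> $ \<sigma>
        = exp (of_real (ising_exponent Jz \<sigma>)) * op_exp (face_sum Jx) $ \<sigma> $ \<sigma>"
      unfolding minus_hamiltonian_eq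
      by (rule op_exp_add_diag) (metis ising_exponent_face_sum)
    then show ?thesis
      unfolding op_exp_face_sum_diagonal[of Jx \<sigma> "\<lambda>_. Plus"]
      by (simp add: ising_weight_eq exp_of_real)
  qed
  have "face_sum Jx $ \<eta> $ \<eta>'
      = of_real (\<Sum>p\<in>UNIV. Jx p * (if \<eta> = flips (bounding_edges p) \<eta>' then 1 else 0))"
    for \<eta> \<eta>'
    unfolding face_sum_entry of_real_sum by (rule sum.cong) auto
  then have "face_sum Jx $ \<eta> $ \<eta>' \<in> \<real>\<^sub>\<ge>\<^sub>0" for \<eta> \<eta>'
    by (simp only: nonneg_Reals_of_real_iff) (simp add: sum_nonneg assms)
  then show "?c \<noteq> 0"
    by (rule op_exp_diagonal_nonzero)
qed


section \<open>Diagonal observables\<close>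

lemma diagonal_observable_eq:
  assumes "\<And>\<sigma>. Q *v ket \<sigma> = q \<sigma> *s ket \<sigma>"
  shows "Q = diag_mat q"
proof -
  have "Q $ \<eta> $ \<sigma> = (if \<eta> = \<sigma> then q \<eta> else 0)" for \<eta> \<sigma>
  proof -
    have "Q $ \<eta> $ \<sigma> = (Q *v ket \<sigma>) $ \<eta>"
      by (simp add: matrix_vector_mult_def ket_entry if_distrib[where f = "\<lambda>x. _ * x"] cong: if_cong)
    also have "\<dots> = (if \<eta> = \<sigma> then q \<eta> else 0)"
      by (simp add: assms ket_entry)
    finally show ?thesis .
  qed
  then show ?thesis
    by (simp add: vec_eq_iff diag_mat_entry)
qed

lemma trace_diag_mat_mult: "trace (diag_mat q ** B) = (\<Sum>i\<in>UNIV. q i * B $ i $ i)"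
  by (simp add: trace_def matrix_matrix_mult_def diag_mat_entry
      if_distrib[where f = "\<lambda>x. x * _"] cong: if_cong)

lemma toric_expectation_diag_mat:
  assumes "\<And>p. 0 \<le> Jx p"
  shows "toric_expectation Jx Jz (diag_mat q) = measure_pmf.expectation (ising Jz) q"
proof -
  obtain c where c: "c \<noteq> 0"
    and diag: "\<And>\<sigma>. op_exp (- hamiltonian Jx Jz) $ \<sigma> $ \<sigma> = c * of_real (ising_weight Jz \<sigma>)"
    using boltzmann_diagonal[of Jx Jz, OF assms] by blast
  let ?Z = "\<Sum>\<tau>\<in>UNIV. complex_of_real (ising_weight Jz \<tau>)"
  have "toric_expectation Jx Jz (diag_mat q)
      = (c * (\<Sum>\<sigma>\<in>UNIV. q \<sigma> * of_real (ising_weight Jz \<sigma>))) / (c * ?Z)"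
    unfolding toric_expectation_def trace_diag_mat_mult diag
    by (simp add: trace_def diag sum_distrib_left mult_ac)
  also have "\<dots> = (\<Sum>\<sigma>\<in>UNIV. q \<sigma> * of_real (ising_weight Jz \<sigma>)) / ?Z"
    using c by simp
  also have "\<dots> = measure_pmf.expectation (ising Jz) q"
    by (subst integral_measure_pmf[of UNIV])
      (simp_all add: pmf_ising scaleR_conv_of_real sum_divide_distrib mult_ac)
  finally show ?thesis .
qed

theorem proposition1p2:
  fixes Jx :: "('m::finite, 'n::finite) face \<Rightarrow> real"
    and Jz :: "('m, 'n) vertex \<Rightarrow> real"
    and Q :: "('m, 'n) operator"
    and q :: "('m, 'n) config \<Rightarrow> complex"
  assumes "\<And>p. 0 \<le> Jx p"
    and "\<And>s. 0 \<le> Jz s"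
    and "\<And>\<sigma>. Q *v ket \<sigma> = q \<sigma> *s ket \<sigma>"
  shows "toric_expectation Jx Jz Q = measure_pmf.expectation (ising Jz) q
    \<and> (\<forall>Jx'. (\<forall>p. 0 \<le> Jx' p) \<longrightarrow> toric_expectation Jx' Jz Q = toric_expectation Jx Jz Q)"
  unfolding diagonal_observable_eq[OF assms(3)]
  using assms(1) toric_expectation_diag_mat by metis

end
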